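(* The number of hyposylvester classes of words of packed evaluation $(i_1,\ldots,i_r)$ (more precisely, of words having a given evaluation whose nonzero terms are $i_1,\dots,i_r$ in this order) is equal to $$(i_2+1)(i_3+1)\cdots(i_r+1).$$ The hyposylvester class of a packed word $u$ is the set of all words $v$ with the same evaluation as $u$ in which the last occurrence of each letter $k$ has exactly as many letters $k+1$ to its left as in $u$. Moreover, each class has a unique element that does not admit any elementary rewriting increasing its number of inversions.
   Context: $A=\{1<2<\cdots\}$ is a totally ordered alphabet and $A^*$ the free monoid on $A$. The hyposylvester congruence $\equiv_{hs}$ is the equivalence relation on $A^*$ generated by the elementary rewritings: (1) $w=x\,ac\,y\leftrightarrow x\,ca\,y$ for letters $a<c$ and words $x,y$, whenever some letter $b$ with $a<b<c$ occurs (anywhere) in $w$; (2) $x\,ab\,y\,a\,z\leftrightarrow x\,ba\,y\,a\,z$ for letters $a<b$ and words $x,y,z$. In both cases, the rewriting from left to right increases the number of inversions (pairs of positions $p<q$ with $w_p>w_q$). The evaluation of a word is the sequence whose $i$-th term is the number of occurrences of the letter $i$; the packed evaluation is obtained by removing its zeros. A word is packed if its set of letters is $\{1,\dots,r\}$ for some $r$. *)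

theory Defs
  imports Main
begin

text \<open>The alphabet \<open>A = {1 < 2 < \<dots>}\<close> is rendered as the positive natural numbers, so
  that \<open>A\<^sup>*\<close> is the set \<open>words\<close>.\<close>

definition words :: "nat list set" where
  "words = lists {1..}"

text \<open>The elementary rewritings, oriented from left to right.\<close>

inductive hs_step :: "nat list \<Rightarrow> nat list \<Rightarrow> bool" where
  hs_step1: "\<lbrakk>x @ [a, c] @ y \<in> words; a < b; b < c; b \<in> set (x @ [a, c] @ y)\<rbrakk>
    \<Longrightarrow> hs_step (x @ [a, c] @ y) (x @ [c, a] @ y)"
| hs_step2: "\<lbrakk>x @ [a, b] @ y @ [a] @ z \<in> words; a < b\<rbrakk>
    \<Longrightarrow> hs_step (x @ [a, b] @ y @ [a] @ z) (x @ [b, a] @ y @ [a] @ z)"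

text \<open>\<open>equivclp\<close> is reflexive on all of \<^typ>\<open>nat list\<close>; the restriction to \<open>words \<times> words\<close> makes
  this the equivalence relation on \<open>A\<^sup>*\<close> generated by \<open>hs_step\<close>.\<close>

definition hyposylvester :: "(nat list \<times> nat list) set" where
  "hyposylvester = {(u, v). u \<in> words \<and> v \<in> words \<and> equivclp hs_step u v}"

definition inversions :: "nat list \<Rightarrow> nat" where
  "inversions w = card {(p, q). p < q \<and> q < length w \<and> w ! p > w ! q}"

text \<open>No elementary rewriting, used in either direction, increases the number of inversions.\<close>

definition inv_maximal :: "nat list \<Rightarrow> bool" where
  "inv_maximal w \<longleftrightarrow> (\<nexists>w'. symclp hs_step w w' \<and> inversions w < inversions w')"

text \<open>Evaluations are indexed by the letters; the entry at 0, which is not a letter, is 0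
  for every word.\<close>

definition evaluation :: "nat list \<Rightarrow> nat \<Rightarrow> nat" where
  "evaluation w = (\<lambda>i. count_list w i)"

text \<open>The sequence \<open>e\<close> with its zeros removed; meaningful when \<open>e\<close> has finite support.\<close>

definition nonzero_terms :: "(nat \<Rightarrow> nat) \<Rightarrow> nat list" where
  "nonzero_terms e = map e (sorted_list_of_set {k. e k \<noteq> 0})"

definition packed :: "nat list \<Rightarrow> bool" where
  "packed w \<longleftrightarrow> (\<exists>r. set w = {1..r})"

text \<open>Positions are counted from 0; \<open>last_occ\<close> is only used for letters occurring in the word.\<close>

definition last_occ :: "nat list \<Rightarrow> nat \<Rightarrow> nat" where
  "last_occ w k = Max {p. p < length w \<and> w ! p = k}"

definition succs_left_of_last :: "nat list \<Rightarrow> nat \<Rightarrow> nat" where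
  "succs_left_of_last w k = card {p. p < last_occ w k \<and> w ! p = k + 1}"

end

theory Submission
  imports Defs
begin

text \<open>Call a word normal if no increasing rewriting applies to it. Every rewriting preserves the
  evaluation and, for consecutive letters \<open>k < l\<close> of the word, the number of \<open>l\<close> to the left of
  the last \<open>k\<close>. As increasing rewritings terminate, it suffices that normal words are determined by
  these data and that all values occur. In a normal word an ascent \<open>a c\<close> consists of the last \<open>a\<close>
  and the next greater letter \<open>c\<close>. Hence, if \<open>m\<close> is the greatest letter and \<open>p\<close> the second greatest, every
  \<open>m\<close> is either in a block at the start of the word or in a block just after the last \<open>p\<close>, so a normal
  word is a normal word without \<open>m\<close> together with the size of the first block, which is the number
  of \<open>m\<close> left of the last \<open>p\<close>. Both claims follow by induction on the number of letters.\<close>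

section \<open>Counting a letter to the left of the last occurrence of another\<close>

text \<open>For \<open>k\<close> \<noteq> \<open>l\<close> this is the number of \<open>l\<close>
  left of the last \<open>k\<close>: an \<open>l\<close> counts exactly if some \<open>k\<close>
  follows it. The recursion avoids positions, and an arbitrary \<open>l\<close> instead of
  \<open>k + 1\<close> allows words that are not packed.\<close>

fun count_before :: "'a \<Rightarrow> 'a \<Rightarrow> 'a list \<Rightarrow> nat" where
  "count_before k l [] = 0"
| "count_before k l (x # w) = (if x = l \<and> k \<in> set w then 1 else 0) + count_before k l w"

lemma count_before_append:
  "count_before k l (u @ v) =
    (if k \<in> set v then count_list u l else count_before k l u) + count_before k l v"
  by (induction u) auto

lemma count_before_notin: "k \<notin> set w \<Longrightarrow> count_before k l w = 0"
  by (induction w) auto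

lemma count_before_filter:
  "P k \<Longrightarrow> P l \<Longrightarrow> count_before k l (filter P w) = count_before k l w"
  by (induction w) auto

lemma count_list_filter: "count_list (filter P w) k = (if P k then count_list w k else 0)"
  by (induction w) auto

lemma count_list_replicate: "count_list (replicate n a) b = (if a = b then n else 0)"
  by (induction n) auto

lemma card_nth_eq_count_list: "card {p. p < length w \<and> w ! p = l} = count_list w l"
  by (auto simp: count_list_eq_length_filter length_filter_conv_card intro: arg_cong[where f = card])

text \<open>Cutting at the last \<open>k\<close> turns both sides into the number of
  \<open>k + 1\<close> in the prefix. This links the positional statistic to the recursive
  one.\<close>

lemma succs_left_of_last_eq:
  assumes "k \<in> set w"
  shows "succs_left_of_last w k = count_before k (k + 1) w"
proof -
  obtain x y where w: "w = x @ k # y" and y: "k \<notin> set y"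
    using split_list_last[OF assms] by blast
  have "Max {p. p < length w \<and> w ! p = k} = length x"
  proof (rule Max_eqI)
    fix q assume q: "q \<in> {p. p < length w \<and> w ! p = k}"
    show "q \<le> length x"
    proof (rule ccontr)
      assume "\<not> q \<le> length x"
      then obtain j where j: "q = length x + Suc j"
        by (metis less_imp_Suc_add not_le add_Suc_right)
      with q w have "j < length y" "y ! j = k"
        by (auto simp: nth_append)
      with y show False by auto
    qed
  qed (auto simp: w)
  then have "succs_left_of_last w k = card {p. p < length x \<and> x ! p = k + 1}"
    unfolding succs_left_of_last_def last_occ_def
    by (intro arg_cong[where f = card]) (auto simp: w nth_append)
  then show ?thesis
    using y by (simp add: w card_nth_eq_count_list count_before_append count_before_notin)
qed

section \<open>Words without increasing rewritings\<close>

text \<open>The list is a factor of a word: \<open>S\<close> stands for the letters of the whole word and \<open>T\<close> for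
  those to the right of the factor.\<close>

fun no_step :: "nat set \<Rightarrow> nat set \<Rightarrow> nat list \<Rightarrow> bool" where
  "no_step S T (a # c # w) \<longleftrightarrow>
    (a < c \<longrightarrow> a \<notin> set w \<union> T \<and> \<not> (\<exists>b\<in>S. a < b \<and> b < c)) \<and> no_step S T (c # w)"
| "no_step S T _ \<longleftrightarrow> True"

definition normal :: "nat list \<Rightarrow> bool" where
  "normal w \<longleftrightarrow> no_step (set w) {} w"

text \<open>Two neighbours lie both in \<open>x @ [p]\<close> or both in \<open>p # y\<close>;
  sharing \<open>p\<close> keeps the pairs at the cut.\<close>

lemma no_step_append:
  "no_step S T (x @ p # y) \<longleftrightarrow> no_step S (set y \<union> T) (x @ [p]) \<and> no_step S T (p # y)"
proof (induction x)
  case (Cons a x)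
  then show ?case by (cases x) auto
qed simp

lemma no_step_Cons_ge:
  "\<forall>a\<in>set w. a \<le> m \<Longrightarrow> no_step S T (m # w) \<longleftrightarrow> no_step S T w"
  by (cases w) auto

lemma no_step_replicate_append:
  "\<forall>a\<in>set w. a \<le> m \<Longrightarrow> no_step S T (replicate c m @ w) \<longleftrightarrow> no_step S T w"
proof (induction c)
  case (Suc c)
  then have "\<forall>a\<in>set (replicate c m @ w). a \<le> m" by auto
  with Suc show ?case by (simp add: no_step_Cons_ge)
qed simp

lemma no_step_cong:
  "T \<inter> set w = T' \<inter> set w \<Longrightarrow> no_step S T w = no_step S T' w"
proof (induction S T w rule: no_step.induct)
  case (1 S T a c w)
  have "no_step S T (c # w) = no_step S T' (c # w)"
    using "1.prems" by (intro "1.IH") auto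
  moreover have "a \<in> T \<longleftrightarrow> a \<in> T'"
    using "1.prems" by auto
  ultimately show ?case by simp
qed auto

text \<open>A letter at least as great as all letters of \<open>w\<close> never lies strictly
  between two of them.\<close>

lemma no_step_insert_ge:
  "\<forall>a\<in>set w. a \<le> m \<Longrightarrow> no_step (insert m S) T w = no_step S T w"
  by (induction S T w rule: no_step.induct) auto

lemma normal_splitD:
  assumes "normal (x @ a # c # y)" "a < c"
  shows "a \<notin> set y" "\<And>b. b \<in> set (x @ a # c # y) \<Longrightarrow> \<not> (a < b \<and> b < c)"
  using assms by (auto simp: normal_def no_step_append[of _ _ x a "c # y"])

lemma normal_iff:
  "normal w \<longleftrightarrow> (\<forall>x a c y. w = x @ a # c # y \<and> a < c \<longrightarrow>
     a \<notin> set y \<and> \<not> (\<exists>b\<in>set w. a < b \<and> b < c))"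
    (is "_ \<longleftrightarrow> ?R")
proof
  assume w: "normal w"
  show ?R
  proof (intro allI impI, elim conjE)
    fix x a c y assume split: "w = x @ a # c # y" "a < c"
    show "a \<notin> set y \<and> \<not> (\<exists>b\<in>set w. a < b \<and> b < c)"
      using normal_splitD[of x a c y] w unfolding split(1) using split(2) by blast
  qed
next
  assume R: ?R
  \<comment> \<open>The set \<open>S\<close> is separated from \<open>v\<close>, so that the
    induction shortens \<open>v\<close> while the letters of the whole word stay fixed.\<close>
  have "no_step S {} v"
    if "\<forall>x a c y. v = x @ a # c # y \<and> a < c \<longrightarrow>
      a \<notin> set y \<and> \<not> (\<exists>b\<in>S. a < b \<and> b < c)" for S v
    using that
  proof (induction v)
    case (Cons d v)
    have "\<forall>x a c y. v = x @ a # c # y \<and> a < c \<longrightarrow>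
        a \<notin> set y \<and> \<not> (\<exists>b\<in>S. a < b \<and> b < c)"
    proof (intro allI impI)
      fix x a c y assume "v = x @ a # c # y \<and> a < c"
      then show "a \<notin> set y \<and> \<not> (\<exists>b\<in>S. a < b \<and> b < c)"
        using Cons.prems[rule_format, of "d # x" a c y] by simp
    qed
    then have "no_step S {} v" by (rule Cons.IH)
    moreover have "d \<notin> set y \<and> \<not> (\<exists>b\<in>S. d < b \<and> b < c)" if "v = c # y" "d < c" for c y
      using Cons.prems[rule_format, of "[]" d c y] that by simp
    ultimately show ?case
      by (cases v) simp_all
  qed simp
  from this[OF R] show "normal w"
    unfolding normal_def .
qed

section \<open>Inserting and deleting the greatest letter\<close>

text \<open>The only ascent that the copies of \<open>m\<close> can create is \<open>p m\<close>. It
  is harmless, as it starts at the last \<open>p\<close> and no letter of the word lies strictly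
  between. No ascent is lost either, since \<open>p\<close> is greater than every letter of
  \<open>y\<close>.\<close>

lemma normal_insert:
  assumes le: "\<forall>a\<in>set (x @ y). a \<le> p" and "p < m" and y: "p \<notin> set y"
  shows "normal (replicate c m @ x @ p # replicate d m @ y) \<longleftrightarrow> normal (x @ p # y)"
proof -
  define S where "S = set (x @ p # y)"
  have lem: "\<forall>a\<in>set (x @ p # y). a \<le> m"
    using le \<open>p < m\<close> by (auto intro: le_trans[of _ p])
  have S: "no_step (set (replicate c m @ x @ p # replicate d m @ y)) T v = no_step S T v"
    if "\<forall>a\<in>set v. a \<le> m" for T v
  proof (cases "c = 0 \<and> d = 0")
    case True
    then show ?thesis by (simp add: S_def)
  next
    case False
    then have "set (replicate c m @ x @ p # replicate d m @ y) = insert m S"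
      by (auto simp: S_def)
    with that show ?thesis by (simp only: no_step_insert_ge)
  qed
  have "normal (replicate c m @ x @ p # replicate d m @ y) \<longleftrightarrow>
      no_step S {} (replicate c m @ x @ p # replicate d m @ y)"
    unfolding normal_def using lem by (intro S) auto
  also have "\<dots> \<longleftrightarrow> no_step S {} (x @ p # replicate d m @ y)"
    using lem by (intro no_step_replicate_append) auto
  also have "\<dots> \<longleftrightarrow> no_step S (set (replicate d m @ y)) (x @ [p]) \<and>
      no_step S {} (p # replicate d m @ y)"
    using no_step_append[of S "{}" x] by simp
  also have "no_step S (set (replicate d m @ y)) (x @ [p]) = no_step S (set y) (x @ [p])"
  proof (rule no_step_cong)
    have "m \<notin> set (x @ [p])"
      using le \<open>p < m\<close> by (auto simp flip: not_le)
    then show "set (replicate d m @ y) \<inter> set (x @ [p]) = set y \<inter> set (x @ [p])" by auto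
  qed
  also have "no_step S {} (p # replicate d m @ y) = no_step S {} y"
  proof (cases d)
    case 0
    then show ?thesis using le by (simp add: no_step_Cons_ge)
  next
    case (Suc d')
    have "no_step S {} (m # replicate d' m @ y) = no_step S {} y"
      using no_step_replicate_append[of y m S "{}" d] lem Suc by simp
    moreover have "\<not> (\<exists>b\<in>S. p < b \<and> b < m)"
      using le by (auto simp: S_def simp flip: not_le)
    ultimately show ?thesis
      using Suc y \<open>p < m\<close> by auto
  qed
  also have "no_step S {} y = no_step S {} (p # y)"
    using le by (simp add: no_step_Cons_ge)
  also have "no_step S (set y) (x @ [p]) \<and> no_step S {} (p # y) \<longleftrightarrow> normal (x @ p # y)"
    using no_step_append[of S "{}" x p y] by (simp add: normal_def S_def)
  finally show ?thesis .
qed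

text \<open>After the leading block of \<open>m\<close>, the first further \<open>m\<close> would be
  preceded by a letter other than \<open>m\<close>.\<close>

lemma replicate_append_conv:
  assumes "\<And>x q y. w = x @ q # m # y \<Longrightarrow> q = m"
  obtains c y where "w = replicate c m @ y" "m \<notin> set y"
proof
  let ?c = "length (takeWhile ((=) m) w)" and ?y = "dropWhile ((=) m) w"
  have "takeWhile ((=) m) w = replicate ?c m"
    by (rule sym, rule replicate_length_same) (auto dest: set_takeWhileD)
  then show w: "w = replicate ?c m @ ?y"
    using takeWhile_dropWhile_id[of "(=) m" w] by simp
  show "m \<notin> set ?y"
  proof
    assume "m \<in> set ?y"
    then obtain u v where uv: "?y = u @ m # v" "m \<notin> set u"
      using split_list_first by fastforce
    show False
    proof (cases u rule: rev_cases)
      case Nil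
      then show False
        using uv hd_dropWhile[of "(=) m" w] by auto
    next
      case (snoc u' q)
      then have "w = (replicate ?c m @ u') @ q # m # v"
        using w uv by simp
      then have "q = m" by (rule assms)
      with uv snoc show False by simp
    qed
  qed
qed

text \<open>A letter preceding \<open>m\<close> must be \<open>m\<close> itself or the last occurrence of \<open>p\<close>.\<close>

lemma normal_decomp:
  assumes w: "normal w" and m: "\<forall>a\<in>set w. a \<noteq> m \<longrightarrow> a \<le> p" and "p \<in> set w" "p < m"
  obtains c x d y where "w = replicate c m @ x @ p # replicate d m @ y"
    "p \<notin> set y" "m \<notin> set x" "m \<notin> set y"
proof -
  obtain x0 y0 where w0: "w = x0 @ p # y0" and y0: "p \<notin> set y0"
    using split_list_last[OF \<open>p \<in> set w\<close>] by blast
  \<comment> \<open>The case \<open>q = p\<close> fails because \<open>p\<close> occurs again after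
    \<open>x0\<close>, and \<open>q < p\<close> fails because \<open>p\<close> lies strictly between
    \<open>q\<close> and \<open>m\<close>.\<close>
  have A: "q = m" if eq: "x0 = u @ q # m # v" for u q v
  proof (rule ccontr)
    assume "q \<noteq> m"
    then have "q \<le> p" using m by (simp add: w0 eq)
    moreover have "normal (u @ q # m # v @ p # y0)"
      using w by (simp add: w0 eq)
    ultimately show False
      using normal_splitD[of u q m "v @ p # y0"] \<open>p < m\<close> by (cases "q = p") auto
  qed
  obtain c x where x: "x0 = replicate c m @ x" "m \<notin> set x"
    using replicate_append_conv[OF A] .
  have B: "q = m" if eq: "y0 = u @ q # m # v" for u q v
  proof (rule ccontr)
    assume "q \<noteq> m"
    then have "q < p" using m y0 by (simp add: w0 eq le_less)
    moreover have "normal ((x0 @ p # u) @ q # m # v)"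
      using w by (simp add: w0 eq)
    ultimately show False
      using normal_splitD(2)[of "x0 @ p # u" q m v p] \<open>p < m\<close> by simp
  qed
  obtain d y where y: "y0 = replicate d m @ y" "m \<notin> set y"
    using replicate_append_conv[OF B] .
  show thesis
    using that[of c x d y] w0 y0 x y by simp
qed

text \<open>By the decomposition, deleting \<open>m\<close> undoes the insertion of two blocks,
  which does not affect normality.\<close>

lemma normal_filter_neq:
  assumes "normal w" "\<forall>a\<in>set w. a \<noteq> m \<longrightarrow> a \<le> p" "p \<in> set w" "p < m"
  shows "normal (filter (\<lambda>a. a \<noteq> m) w)"
proof -
  obtain c x d y where w: "w = replicate c m @ x @ p # replicate d m @ y"
      "p \<notin> set y" "m \<notin> set x" "m \<notin> set y"
    using normal_decomp[OF assms] .
  have "filter (\<lambda>a. a \<noteq> m) x = x" "filter (\<lambda>a. a \<noteq> m) y = y"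
    using w(3,4) by (auto intro!: filter_True)
  then have "filter (\<lambda>a. a \<noteq> m) w = x @ p # y"
    using \<open>p < m\<close> by (simp add: w(1))
  moreover have "\<forall>a\<in>set (x @ y). a \<le> p"
    using assms(2) w by auto
  ultimately show ?thesis
    using assms(1,4) w normal_insert by simp
qed

lemma last_split_unique:
  assumes "x @ p # y = x' @ p # y'" "p \<notin> set y" "p \<notin> set y'"
  shows "x = x'" "y = y'"
proof -
  have *: "takeWhile (\<lambda>a. a \<noteq> p) (rev (u @ p # v)) = rev v" if "p \<notin> set v" for u v
    using that by (subst rev.simps rev_append; auto simp: takeWhile_append)
  show "y = y'"
    using *[of y x] *[of y' x'] assms by simp
  then show "x = x'"
    using assms(1) by simp
qed

text \<open>The decomposition can be read off: cutting the word without \<open>m\<close> at its last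
  \<open>p\<close> gives \<open>x\<close> and \<open>y\<close>, the number of \<open>m\<close> left
  of the last \<open>p\<close> is \<open>c\<close>, and the remaining copies of \<open>m\<close>
  give \<open>d\<close>.\<close>

lemma normal_eqI:
  assumes w: "normal w" "\<forall>a\<in>set w. a \<noteq> m \<longrightarrow> a \<le> p" "p \<in> set w"
    and w': "normal w'" "\<forall>a\<in>set w'. a \<noteq> m \<longrightarrow> a \<le> p" "p \<in> set w'"
    and "p < m"
    and count: "count_list w m = count_list w' m"
    and before: "count_before p m w = count_before p m w'"
    and filter: "filter (\<lambda>a. a \<noteq> m) w = filter (\<lambda>a. a \<noteq> m) w'"
  shows "w = w'"
proof -
  have data: "\<exists>c x d y. v = replicate c m @ x @ p # replicate d m @ y \<and> p \<notin> set y \<and>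
      filter (\<lambda>a. a \<noteq> m) v = x @ p # y \<and> count_list v m = c + d \<and> count_before p m v = c"
    if v: "normal v" "\<forall>a\<in>set v. a \<noteq> m \<longrightarrow> a \<le> p" "p \<in> set v" for v
  proof -
    obtain c x d y where v: "v = replicate c m @ x @ p # replicate d m @ y"
        "p \<notin> set y" "m \<notin> set x" "m \<notin> set y"
      using normal_decomp[OF v \<open>p < m\<close>] .
    have "filter (\<lambda>a. a \<noteq> m) x = x" "filter (\<lambda>a. a \<noteq> m) y = y"
      using v(3,4) by (auto intro!: filter_True)
    moreover have "count_before p m (replicate d m @ y) = 0"
      using v(2) \<open>p < m\<close> by (intro count_before_notin) auto
    ultimately show ?thesis
      using v \<open>p < m\<close>
      by (intro exI[of _ c] exI[of _ x] exI[of _ d] exI[of _ y])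
        (auto simp: count_before_append count_list_replicate count_list_0_iff)
  qed
  obtain c x d y where 1: "w = replicate c m @ x @ p # replicate d m @ y" "p \<notin> set y"
      "filter (\<lambda>a. a \<noteq> m) w = x @ p # y" "count_list w m = c + d" "count_before p m w = c"
    using data[OF w] by blast
  obtain c' x' d' y' where 2: "w' = replicate c' m @ x' @ p # replicate d' m @ y'" "p \<notin> set y'"
      "filter (\<lambda>a. a \<noteq> m) w' = x' @ p # y'" "count_list w' m = c' + d'" "count_before p m w' = c'"
    using data[OF w'] by blast
  have "x = x'" "y = y'"
    using last_split_unique[of x p y x' y'] filter 1 2 by simp_all
  then show ?thesis
    using 1 2 count before by simp
qed

section \<open>Normal words are determined by their invariants\<close>

lemma set_eq_count_list: "set w = {k. count_list w k \<noteq> 0}"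
  by (auto simp: count_list_0_iff)

lemma set_eq_if_count_list_eq: "count_list v = count_list w \<Longrightarrow> set v = set w"
  by (simp only: set_eq_count_list[of v] set_eq_count_list[of w])

lemma eq_replicate_if_set_subset: "set w \<subseteq> {m} \<Longrightarrow> w = replicate (count_list w m) m"
  by (induction w) auto

text \<open>Deleting the greatest letter leaves normal words with fewer distinct letters, and
  \<open>normal_eqI\<close> restores the deleted letter. Consecutive letters are described by the
  absence of letters in between, so gaps in the alphabet of \<open>w\<close> are allowed.\<close>

lemma normal_unique:
  assumes "normal w" "normal w'" "count_list w = count_list w'"
    and "\<And>k l. \<lbrakk>k \<in> set w; l \<in> set w; k < l; \<forall>b\<in>set w. \<not> (k < b \<and> b < l)\<rbrakk> \<Longrightarrow>
      count_before k l w = count_before k l w'"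
  shows "w = w'"
  using assms
proof (induction "card (set w)" arbitrary: w w' rule: less_induct)
  case less
  have set_eq: "set w = set w'"
    using less.prems by (intro set_eq_if_count_list_eq)
  show ?case
  proof (cases "\<exists>m. set w \<subseteq> {m}")
    \<comment> \<open>At most one distinct letter, the empty word included, so there is no second
      greatest letter.\<close>
    case True
    then show ?thesis
      using less.prems(3) set_eq by (metis eq_replicate_if_set_subset)
  next
    case False
    define m where "m = Max (set w)"
    define p where "p = Max (set w - {m})"
    have ne: "set w - {m} \<noteq> {}" "set w \<noteq> {}"
      using False by auto
    have m: "m \<in> set w" "\<And>a. a \<in> set w \<Longrightarrow> a \<le> m"
      using ne by (auto simp: m_def)
    have "p \<in> set w - {m}"
      unfolding p_def using ne by (intro Max_in) auto
    then have p: "p \<in> set w" "p < m"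
      using m(2) by (auto simp: order.strict_iff_order)
    have le_p: "\<forall>a\<in>set w. a \<noteq> m \<longrightarrow> a \<le> p"
      by (auto simp: p_def)
    let ?f = "filter (\<lambda>a. a \<noteq> m)"
    have "?f w = ?f w'"
    proof (rule less.hyps)
      show "card (set (?f w)) < card (set w)"
        using m(1) by (intro psubset_card_mono) auto
      show "normal (?f w)" "normal (?f w')"
        using normal_filter_neq less.prems(1,2) le_p p set_eq by metis+
      show "count_list (?f w) = count_list (?f w')"
        using less.prems(3) by (auto simp: count_list_filter)
      fix k l
      assume kl: "k \<in> set (?f w)" "l \<in> set (?f w)" "k < l"
        "\<forall>b\<in>set (?f w). \<not> (k < b \<and> b < l)"
      \<comment> \<open>The greatest letter \<open>m\<close> is never strictly below
        \<open>l\<close>, so letters consecutive after its deletion were consecutive before.\<close>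
      then have "\<forall>b\<in>set w. \<not> (k < b \<and> b < l)"
        using m(2)[of l] by auto
      then have "count_before k l w = count_before k l w'"
        using kl by (intro less.prems(4)) auto
      then show "count_before k l (?f w) = count_before k l (?f w')"
        using kl by (simp add: count_before_filter)
    qed
    moreover have "count_before p m w = count_before p m w'"
      using p m(1) le_p by (intro less.prems(4)) auto
    ultimately show ?thesis
      using less.prems le_p p set_eq by (intro normal_eqI[of w m p]) auto
  qed
qed

section \<open>Counting normal words of a given evaluation\<close>

text \<open>Deleting the greatest letter \<open>m\<close> and recording how many \<open>m\<close>
  precede the last \<open>p\<close> is a bijection onto pairs of a number in \<open>{..e m}\<close>
  and a normal word of the remaining evaluation. Each letter thus contributes a factor
  \<open>e m + 1\<close>, except the smallest, which has no \<open>p\<close> below it; hence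
  \<open>tl\<close>.\<close>

lemma card_normal:
  assumes "sorted_wrt (<) s" "{k. e k \<noteq> 0} = set s"
  shows "card {w. normal w \<and> count_list w = e} = (\<Prod>k\<leftarrow>tl s. e k + 1)"
  using assms
proof (induction s arbitrary: e rule: rev_induct)
  case Nil
  then have e: "e = (\<lambda>_. 0)" by auto
  have "w = []" if "count_list w = e" for w
    using set_eq_count_list[of w] unfolding that e by simp
  then have "{w. normal w \<and> count_list w = e} = {[]}"
    by (auto simp: e normal_def)
  then show ?case by simp
next
  case (snoc m s)
  have set_w: "set w = insert m (set s)" if "count_list w = e" for w
    using snoc.prems(2) set_eq_count_list[of w] unfolding that by simp
  show ?case
  proof (cases s rule: rev_cases)
    case Nil
    have "{w. normal w \<and> count_list w = e} = {replicate (e m) m}"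
    proof (intro set_eqI iffI)
      fix w assume "w \<in> {w. normal w \<and> count_list w = e}"
      then show "w \<in> {replicate (e m) m}"
        using set_w[of w] eq_replicate_if_set_subset[of w m] Nil by auto
    next
      fix w assume w: "w \<in> {replicate (e m) m}"
      have "normal (replicate (e m) m)"
        using no_step_replicate_append[of "[]" m _ "{}" "e m"] by (simp add: normal_def)
      moreover have "e k = 0" if "k \<noteq> m" for k
      proof -
        have "k \<notin> {k. e k \<noteq> 0}"
          unfolding snoc.prems(2) using Nil that by simp
        then show ?thesis by simp
      qed
      ultimately show "w \<in> {w. normal w \<and> count_list w = e}"
        using w by (auto simp: count_list_replicate)
    qed
    then show ?thesis using Nil by simp
  next
    case (snoc t p)
    let ?f = "filter (\<lambda>a. a \<noteq> m)"
    define e' where "e' = e(m := 0)"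
    define A where "A = {w. normal w \<and> count_list w = e}"
    define B where "B = {w. normal w \<and> count_list w = e'}"
    have s: "sorted_wrt (<) s" "\<forall>a\<in>set s. a < m"
      using snoc.prems(1) by (auto simp: sorted_wrt_append)
    have p: "p \<in> set s" "p < m" "\<forall>a\<in>set s. a \<le> p"
      using s snoc by (auto simp: sorted_wrt_append less_imp_le)
    have e': "{k. e' k \<noteq> 0} = set s"
      using snoc.prems(2) s by (auto simp: e'_def)
    have set_B: "set w = set s" if "count_list w = e'" for w
      using e' set_eq_count_list[of w] unfolding that by simp
    have A: "normal w" "\<forall>a\<in>set w. a \<noteq> m \<longrightarrow> a \<le> p" "p \<in> set w" if "w \<in> A" for w
      using that set_w[of w] p by (auto simp: A_def)
    have "bij_betw (\<lambda>w. (count_before p m w, ?f w)) A ({..e m} \<times> B)"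
    proof (rule bij_betw_imageI)
      show "inj_on (\<lambda>w. (count_before p m w, ?f w)) A"
      proof (rule inj_onI)
        fix v w
        assume vw: "v \<in> A" "w \<in> A" "(count_before p m v, ?f v) = (count_before p m w, ?f w)"
        then have "count_list v m = count_list w m"
          by (simp add: A_def)
        with vw A show "v = w"
          by (intro normal_eqI[of v m p w] p) auto
      qed
      show "(\<lambda>w. (count_before p m w, ?f w)) ` A = {..e m} \<times> B"
      proof (intro equalityI subsetI)
        fix z assume "z \<in> (\<lambda>w. (count_before p m w, ?f w)) ` A"
        then obtain w where w: "w \<in> A" "z = (count_before p m w, ?f w)"
          by auto
        have "count_before p m v \<le> count_list v m" for v
          by (induction v) auto
        then have "count_before p m w \<le> e m"
          using w(1) by (metis (mono_tags, lifting) A_def mem_Collect_eq)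
        moreover have "count_list (?f w) = e'"
          using w(1) by (auto simp: A_def e'_def count_list_filter)
        ultimately show "z \<in> {..e m} \<times> B"
          using w normal_filter_neq[OF A[OF w(1)] p(2)] by (auto simp: B_def)
      next
        fix z assume "z \<in> {..e m} \<times> B"
        then obtain c v where z: "z = (c, v)" "c \<le> e m" "normal v" "count_list v = e'"
          by (auto simp: B_def)
        have set_v: "set v = set s"
          using set_B z(4) .
        then obtain x y where v: "v = x @ p # y" and y: "p \<notin> set y"
          using split_list_last[of p v] p(1) by auto
        \<comment> \<open>Of the \<open>e m\<close> copies of \<open>m\<close>, \<open>c\<close> go
          to the front and so precede the last \<open>p\<close>; the other \<open>d\<close> directly
          follow it.\<close>
        define d where "d = e m - c"
        define w where "w = replicate c m @ x @ p # replicate d m @ y"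
        have xy: "\<forall>a\<in>set (x @ y). a \<le> p"
          using set_v v p(3) by auto
        then have m: "m \<notin> set x" "m \<notin> set y"
          using p(2) by (auto simp flip: not_le)
        have "normal w"
          unfolding w_def using normal_insert[OF xy p(2) y] z(3) v by simp
        moreover have "count_list w = e"
        proof
          fix k
          have "e' k = count_list (x @ p # y) k"
            using z(4) v by simp
          then show "count_list w k = e k"
            using m p(2) z(2)
            by (cases "k = m") (auto simp: w_def d_def e'_def count_list_replicate count_list_0_iff)
        qed
        ultimately have "w \<in> A" by (simp add: A_def)
        moreover have "?f w = v"
        proof -
          have "?f x = x" "?f y = y"
            using m by (auto intro!: filter_True)
          then show ?thesis using p(2) by (simp add: w_def v)
        qed
        moreover have "count_before p m w = c"
        proof -
          have "count_before p m (replicate d m @ y) = 0"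
            using y p(2) by (intro count_before_notin) auto
          then show ?thesis
            using y p(2) m
            by (auto simp: w_def count_before_append count_list_replicate count_list_0_iff)
        qed
        ultimately show "z \<in> (\<lambda>w. (count_before p m w, ?f w)) ` A"
          using z(1) by (intro image_eqI[of _ _ w]) auto
      qed
    qed
    then have "card A = card ({..e m} \<times> B)"
      by (rule bij_betw_same_card)
    also have "\<dots> = (e m + 1) * card B"
      by (simp add: card_cartesian_product)
    also have "card B = (\<Prod>k\<leftarrow>tl s. e' k + 1)"
      unfolding B_def by (rule snoc.IH[OF s(1) e'])
    also have "map (\<lambda>k. e' k + 1) (tl s) = map (\<lambda>k. e k + 1) (tl s)"
      using s(2) by (cases s) (auto simp: e'_def)
    finally have "card A = (e m + 1) * (\<Prod>k\<leftarrow>tl s. e k + 1)" .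
    moreover have "tl (s @ [m]) = tl s @ [m]"
      using snoc by (intro tl_append2) simp
    ultimately show ?thesis
      by (simp add: A_def)
  qed
qed

section \<open>Inversions and invariants of a single rewriting\<close>

text \<open>Inversions with first position 0 are counted by the letters of \<open>w\<close> below
  \<open>a\<close>; all others are shifted inversions of \<open>w\<close>.\<close>

lemma inversions_Cons: "inversions (a # w) = length (filter (\<lambda>b. b < a) w) + inversions w"
proof -
  let ?I = "\<lambda>w. {(p, q). p < q \<and> q < length w \<and> w ! p > (w ! q :: nat)}"
  have fin: "finite (?I v)" for v
    by (rule finite_subset[of _ "{..<length v} \<times> {..<length v}"]) auto
  have "?I (a # w) = (\<lambda>q. (0, Suc q)) ` {q. q < length w \<and> w ! q < a} \<union> map_prod Suc Suc ` ?I w"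
    (is "_ = ?A \<union> ?B")
  proof (intro equalityI subsetI)
    fix z assume "z \<in> ?I (a # w)"
    then obtain p q where z: "z = (p, q)" "p < q" "q < Suc (length w)" "(a # w) ! q < (a # w) ! p"
      by auto
    then obtain q' where q: "q = Suc q'" by (cases q) auto
    show "z \<in> ?A \<union> ?B"
    proof (cases p)
      case 0
      with z q show ?thesis by auto
    next
      case (Suc p')
      with z q have "(p', q') \<in> ?I w" by auto
      with z q Suc show ?thesis by (force simp: image_iff)
    qed
  qed auto
  moreover have "card (?A \<union> ?B) = card ?A + card ?B"
    using fin[of w] by (intro card_Un_disjoint) auto
  moreover have "card ?A = length (filter (\<lambda>b. b < a) w)"
    by (subst card_image) (auto simp: inj_on_def length_filter_conv_card)
  moreover have "card ?B = card (?I w)"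
    by (intro card_image) (auto simp: inj_on_def)
  ultimately show ?thesis
    unfolding inversions_def by simp
qed

lemma inversions_le: "inversions w \<le> length w * length w"
proof -
  have "inversions w \<le> card ({..<length w} \<times> {..<length w})"
    unfolding inversions_def by (intro card_mono) auto
  then show ?thesis by simp
qed

lemma inversions_swap: "a < c \<Longrightarrow> inversions (x @ a # c # y) < inversions (x @ c # a # y)"
  by (induction x) (auto simp: inversions_Cons)

lemma words_iff: "w \<in> words \<longleftrightarrow> 0 \<notin> set w"
  unfolding words_def in_lists_conv_set by (metis atLeast_iff less_one not_le)

text \<open>Both rules swap an adjacent ascent and differ only in the side condition. The resulting
  disjunction is the negation of the condition in \<open>normal_iff\<close>.\<close>

lemma hs_step_iff:
  "hs_step u v \<longleftrightarrow> u \<in> words \<and> (\<exists>x a c y. u = x @ a # c # y \<and> v = x @ c # a # y \<and> a < c \<and>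
     (a \<in> set y \<or> (\<exists>b\<in>set u. a < b \<and> b < c)))"
    (is "_ \<longleftrightarrow> ?R")
proof
  assume "hs_step u v"
  then show ?R
  proof cases
    case (hs_step1 x a c y b)
    then show ?thesis
      by (intro conjI exI[of _ x] exI[of _ a] exI[of _ c] exI[of _ y]) auto
  next
    case (hs_step2 x a b y z)
    then show ?thesis
      by (intro conjI exI[of _ x] exI[of _ a] exI[of _ b] exI[of _ "y @ a # z"]) auto
  qed
next
  assume ?R
  then obtain x a c y where u: "u \<in> words" "u = x @ a # c # y" "v = x @ c # a # y" "a < c"
    and *: "a \<in> set y \<or> (\<exists>b\<in>set u. a < b \<and> b < c)"
    by blast
  from * show "hs_step u v"
  proof
    assume "a \<in> set y"
    then obtain y1 y2 where "y = y1 @ a # y2"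
      by (meson split_list)
    then show ?thesis
      using hs_step2[of x a c y1 y2] u by simp
  next
    assume "\<exists>b\<in>set u. a < b \<and> b < c"
    then show ?thesis
      using hs_step1[of x a c y] u by auto
  qed
qed

lemma hs_step_inversions: "hs_step u v \<Longrightarrow> inversions u < inversions v"
  by (auto simp: hs_step_iff inversions_swap)

text \<open>Rewritings from left to right strictly increase \<open>inversions\<close>, so those from
  right to left decrease it, and maximality only concerns the former.\<close>

lemma inv_maximal_iff_normal: "w \<in> words \<Longrightarrow> inv_maximal w \<longleftrightarrow> normal w"
proof -
  assume "w \<in> words"
  have "inv_maximal w \<longleftrightarrow> (\<nexists>w'. hs_step w w')"
    unfolding inv_maximal_def symclp_def by (meson hs_step_inversions less_asym)
  also have "\<dots> \<longleftrightarrow> normal w"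
    unfolding hs_step_iff normal_iff using \<open>w \<in> words\<close> by blast
  finally show ?thesis .
qed

text \<open>Swapping \<open>a\<close> and \<open>c\<close> can affect
  \<open>count_before k l\<close> only if \<open>a = k\<close> and \<open>c = l\<close>. With no
  letter in between, another \<open>a\<close> must follow, so the swapped one is not the last
  \<open>k\<close>.\<close>

lemma hs_step_invariants:
  assumes "hs_step u v"
  shows "u \<in> words" "v \<in> words" "count_list v = count_list u"
    and "k < l \<Longrightarrow> \<forall>b\<in>set u. \<not> (k < b \<and> b < l) \<Longrightarrow> count_before k l v = count_before k l u"
proof -
  obtain x a c y where u: "u \<in> words" "u = x @ a # c # y" "v = x @ c # a # y" "a < c"
    and *: "a \<in> set y \<or> (\<exists>b\<in>set u. a < b \<and> b < c)"
    using assms unfolding hs_step_iff by blast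
  show "u \<in> words" "v \<in> words" "count_list v = count_list u"
    using u by (auto simp: words_iff)
  assume "k < l" "\<forall>b\<in>set u. \<not> (k < b \<and> b < l)"
  then show "count_before k l v = count_before k l u"
    using * u(4) unfolding u(2,3) by (auto simp: count_before_append)
qed

section \<open>Classes and their normal forms\<close>

lemma hyposylvester_iff:
  "(u, v) \<in> hyposylvester \<longleftrightarrow> u \<in> words \<and> equivclp hs_step u v"
proof -
  have "v \<in> words" if "equivclp hs_step u v" "u \<in> words"
    using that by induction (auto dest: hs_step_invariants(1,2))
  then show ?thesis
    by (auto simp: hyposylvester_def)
qed

lemma equiv_hyposylvester: "equiv words hyposylvester"
  by (rule equivI)
    (auto simp: hyposylvester_def refl_on_def sym_def trans_def
      intro: equivclp_sym equivclp_trans)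

lemma hyposylvester_invariants:
  assumes "(u, v) \<in> hyposylvester"
  shows "count_list v = count_list u"
    and "k < l \<Longrightarrow> \<forall>b\<in>set u. \<not> (k < b \<and> b < l) \<Longrightarrow> count_before k l v = count_before k l u"
proof -
  have eq: "equivclp hs_step u v"
    using assms by (simp add: hyposylvester_iff)
  have *: "count_list v = count_list u \<and>
    (k < l \<longrightarrow> (\<forall>b\<in>set u. \<not> (k < b \<and> b < l)) \<longrightarrow> count_before k l v = count_before k l u)" for k l
    using eq
  proof induction
    case (step y z)
    then have count: "count_list z = count_list u" "count_list y = count_list u"
      using hs_step_invariants(3)[of y z] hs_step_invariants(3)[of z y] by auto
    \<comment> \<open>Consecutiveness is assumed for the letters of \<open>u\<close>, whereas the
      step from \<open>y\<close> to \<open>z\<close>, in either direction, needs it for those of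
      \<open>y\<close> or \<open>z\<close>; equal evaluations give equal letter sets.\<close>
    note set_eq = count[THEN set_eq_if_count_list_eq]
    show ?case
      using step.hyps(2) step.IH count set_eq
        hs_step_invariants(4)[of y z k l] hs_step_invariants(4)[of z y k l] by auto
  qed simp
  show "count_list v = count_list u"
    using * by blast
  show "k < l \<Longrightarrow> \<forall>b\<in>set u. \<not> (k < b \<and> b < l) \<Longrightarrow> count_before k l v = count_before k l u"
    using * by blast
qed

text \<open>An element of the class with the most inversions is normal. It exists because all
  elements have the length of \<open>u\<close>, which bounds their inversions.\<close>

lemma ex_normal:
  assumes "u \<in> words"
  obtains w where "(u, w) \<in> hyposylvester" "normal w"
proof -
  let ?P = "\<lambda>w. (u, w) \<in> hyposylvester"
  have len: "length w = length u" if "?P w" for w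
  proof -
    have count: "count_list w = count_list u"
      using that by (rule hyposylvester_invariants(1))
    then have "set w = set u"
      by (rule set_eq_if_count_list_eq)
    then show ?thesis
      using sum_count_set[of w "set u"] sum_count_set[of u "set u"] count by simp
  qed
  have "?P u"
    using assms by (simp add: hyposylvester_iff)
  moreover have "inversions w < Suc (length u * length u)" if "?P w" for w
    using inversions_le[of w] len[OF that] by simp
  ultimately obtain w where w: "?P w" "\<forall>v. ?P v \<longrightarrow> inversions v \<le> inversions w"
    using ex_has_greatest_nat[of ?P u inversions "Suc (length u * length u)"] by blast
  have "?P v" if "symclp hs_step w v" for v
    using w(1) that equivclp_into_equivclp[of hs_step u w v]
    unfolding hyposylvester_iff symclp_def by blast
  with w(2) have "inv_maximal w"
    unfolding inv_maximal_def by (meson not_le)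
  moreover have "w \<in> words"
    using w(1) by (simp add: hyposylvester_def)
  ultimately show thesis
    using that w(1) inv_maximal_iff_normal by blast
qed

lemma hyposylvester_normal_unique:
  assumes "(v, w) \<in> hyposylvester" "normal v" "normal w"
  shows "v = w"
  using assms hyposylvester_invariants[OF assms(1)] by (intro normal_unique) auto

text \<open>The converse of the invariance: the normal forms of \<open>u\<close> and
  \<open>v\<close> have the same invariants, hence coincide by \<open>normal_unique\<close>.\<close>

lemma hyposylvesterI:
  assumes "u \<in> words" "v \<in> words" "count_list v = count_list u"
    and before: "\<And>k l. \<lbrakk>k \<in> set u; l \<in> set u; k < l; \<forall>b\<in>set u. \<not> (k < b \<and> b < l)\<rbrakk> \<Longrightarrow>
      count_before k l v = count_before k l u"
  shows "(u, v) \<in> hyposylvester"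
proof -
  obtain u' where u': "(u, u') \<in> hyposylvester" "normal u'"
    using ex_normal[OF assms(1)] .
  obtain v' where v': "(v, v') \<in> hyposylvester" "normal v'"
    using ex_normal[OF assms(2)] .
  note inv = hyposylvester_invariants[OF u'(1)] hyposylvester_invariants[OF v'(1)]
  note sets = assms(3)[THEN set_eq_if_count_list_eq] inv(1)[THEN set_eq_if_count_list_eq]
  have "u' = v'"
    using u'(2) v'(2) inv assms(3) before sets by (intro normal_unique) simp_all
  then show ?thesis
    using u'(1) v'(1) equiv_hyposylvester by (metis equivE symD transD)
qed

lemma hyposylvester_class_packed:
  assumes "u \<in> words" "packed u"
  shows "hyposylvester `` {u} = {v \<in> words. evaluation v = evaluation u \<and>
    (\<forall>k\<in>set u. succs_left_of_last v k = succs_left_of_last u k)}"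
proof (intro set_eqI iffI)
  fix v assume "v \<in> hyposylvester `` {u}"
  then have uv: "(u, v) \<in> hyposylvester" by simp
  note inv = hyposylvester_invariants[OF uv]
  have "set v = set u"
    using inv(1) by (rule set_eq_if_count_list_eq)
  then have "succs_left_of_last v k = succs_left_of_last u k" if "k \<in> set u" for k
    using that inv(2)[of k "k + 1"] by (simp add: succs_left_of_last_eq)
  then show "v \<in> {v \<in> words. evaluation v = evaluation u \<and>
      (\<forall>k\<in>set u. succs_left_of_last v k = succs_left_of_last u k)}"
    using uv inv(1) by (simp add: hyposylvester_def evaluation_def)
next
  fix v assume "v \<in> {v \<in> words. evaluation v = evaluation u \<and>
      (\<forall>k\<in>set u. succs_left_of_last v k = succs_left_of_last u k)}"
  then have v: "v \<in> words" "count_list v = count_list u"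
    "\<And>k. k \<in> set u \<Longrightarrow> succs_left_of_last v k = succs_left_of_last u k"
    by (auto simp: evaluation_def)
  obtain r where r: "set u = {1..r}"
    using assms(2) by (auto simp: packed_def)
  have "(u, v) \<in> hyposylvester"
  proof (rule hyposylvesterI)
    fix k l assume kl: "k \<in> set u" "l \<in> set u" "k < l" "\<forall>b\<in>set u. \<not> (k < b \<and> b < l)"
    \<comment> \<open>The letters fill \<open>{1..r}\<close>, so consecutive letters differ by 1 and
      \<open>succs_left_of_last\<close> covers every pair that \<open>hyposylvesterI\<close> asks
      for.\<close>
    then have "k + 1 \<in> set u"
      using r by auto
    with kl have "l = k + 1" by (metis Suc_eq_plus1 Suc_lessI lessI)
    moreover have "k \<in> set v"
      using kl(1) set_eq_if_count_list_eq[OF v(2)] by simp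
    ultimately show "count_before k l v = count_before k l u"
      using v(3)[OF kl(1)] kl(1) succs_left_of_last_eq[of k] by simp
  qed (use assms v in auto)
  then show "v \<in> hyposylvester `` {u}" by simp
qed

lemma ex1_inv_maximal:
  assumes "C \<in> words // hyposylvester"
  shows "\<exists>!w. w \<in> C \<and> inv_maximal w"
proof -
  obtain u where u: "u \<in> words" "C = hyposylvester `` {u}"
    using assms by (auto elim: quotientE)
  obtain w where w: "(u, w) \<in> hyposylvester" "normal w"
    using ex_normal[OF u(1)] .
  have max: "inv_maximal v \<longleftrightarrow> normal v" if "v \<in> C" for v
    using that inv_maximal_iff_normal by (simp add: u(2) hyposylvester_def)
  show ?thesis
  proof (rule ex1I[of _ w])
    show "w \<in> C \<and> inv_maximal w"
      using w max u(2) by simp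
    fix v assume v: "v \<in> C \<and> inv_maximal v"
    then have "(v, w) \<in> hyposylvester"
      using w(1) u(2) equiv_hyposylvester by (metis Image_singleton_iff equivE symD transD)
    then show "v = w"
      using hyposylvester_normal_unique v w(2) max by blast
  qed
qed

section \<open>Counting the classes\<close>

text \<open>Each class contains exactly one normal word, so mapping normal words to their classes is
  a bijection. The condition \<open>e 0 = 0\<close> keeps the non-letter 0 out, which places all
  lists of evaluation \<open>e\<close> in \<open>words\<close>.\<close>

lemma card_classes:
  fixes e :: "nat \<Rightarrow> nat"
  assumes "e 0 = 0"
  shows "card ({w \<in> words. evaluation w = e} // hyposylvester) =
    card {w. normal w \<and> count_list w = e}"
proof -
  let ?X = "{w \<in> words. evaluation w = e}" and ?N = "{w. normal w \<and> count_list w = e}"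
  have "w \<in> words" if "count_list w = e" for w
    using that assms by (auto simp: words_iff count_list_0_iff[symmetric])
  then have N: "?N = {w \<in> ?X. normal w}"
    by (auto simp: evaluation_def)
  have "bij_betw (\<lambda>w. hyposylvester `` {w}) ?N (?X // hyposylvester)"
  proof (rule bij_betw_imageI)
    show "inj_on (\<lambda>w. hyposylvester `` {w}) ?N"
    proof (rule inj_onI)
      fix v w assume vw: "v \<in> ?N" "w \<in> ?N" "hyposylvester `` {v} = hyposylvester `` {w}"
      then have "w \<in> words" using N by blast
      with vw(3) have "(v, w) \<in> hyposylvester"
        by (rule eq_equiv_class[OF _ equiv_hyposylvester])
      with vw(1,2) show "v = w"
        by (intro hyposylvester_normal_unique) auto
    qed
    show "(\<lambda>w. hyposylvester `` {w}) ` ?N = ?X // hyposylvester"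
    proof (intro equalityI subsetI)
      fix C assume "C \<in> ?X // hyposylvester"
      then obtain u where u: "u \<in> ?X" "C = hyposylvester `` {u}"
        by (auto elim: quotientE)
      then obtain w where w: "(u, w) \<in> hyposylvester" "normal w"
        using ex_normal by blast
      then have "w \<in> ?N"
        using u(1) hyposylvester_invariants(1)[OF w(1)] by (simp add: evaluation_def)
      then show "C \<in> (\<lambda>w. hyposylvester `` {w}) ` ?N"
        using u(2) equiv_class_eq[OF equiv_hyposylvester w(1)] by blast
    qed (auto simp: N intro: quotientI)
  qed
  then show ?thesis
    by (rule bij_betw_same_card[symmetric])
qed

lemma card_classes_eq_prod:
  fixes e :: "nat \<Rightarrow> nat"
  assumes "finite {k. e k \<noteq> 0}" "e 0 = 0" "nonzero_terms e = map i [1..<r + 1]"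
  shows "card ({w \<in> words. evaluation w = e} // hyposylvester) = (\<Prod>j = 2..r. i j + 1)"
proof -
  define s where "s = sorted_list_of_set {k. e k \<noteq> 0}"
  have s: "sorted_wrt (<) s" "{k. e k \<noteq> 0} = set s"
    using assms(1) by (simp_all add: s_def strict_sorted_list_of_set)
  have "card ({w \<in> words. evaluation w = e} // hyposylvester) = (\<Prod>k\<leftarrow>tl s. e k + 1)"
    using card_classes[of e] assms(2) card_normal[OF s] by simp
  also have "\<dots> = prod_list (map Suc (tl (map e s)))"
    by (simp add: map_tl o_def)
  also have "map e s = map i [1..<r + 1]"
    using assms(3) by (simp add: nonzero_terms_def s_def)
  \<comment> \<open>The tail drops the index 1, so the product starts at 2; for \<open>r = 0\<close>
    both lists are empty.\<close>
  also have "tl (map i [1..<r + 1]) = map i [2..<Suc r]"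
    by (simp add: map_tl[symmetric] tl_upt numeral_2_eq_2)
  also have "prod_list (map Suc (map i [2..<Suc r])) = (\<Prod>j = 2..r. i j + 1)"
    by (simp add: prod.distinct_set_conv_list[symmetric] atLeastLessThanSuc_atLeastAtMost o_def
        del: upt_Suc)
  finally show ?thesis .
qed

theorem theorem3p4:
  shows "(\<forall>(r::nat) (i::nat \<Rightarrow> nat) (e::nat \<Rightarrow> nat).
            finite {k. e k \<noteq> 0} \<and> e 0 = 0 \<and> nonzero_terms e = map i [1..<r + 1]
            \<longrightarrow> card ({w \<in> words. evaluation w = e} // hyposylvester) = (\<Prod>j = 2..r. i j + 1))
       \<and> (\<forall>u \<in> words. packed u \<longrightarrow>
            hyposylvester `` {u} =
              {v \<in> words. evaluation v = evaluation u \<and>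
                 (\<forall>k \<in> set u. succs_left_of_last v k = succs_left_of_last u k)})
       \<and> (\<forall>C \<in> words // hyposylvester. \<exists>!w. w \<in> C \<and> inv_maximal w)"
  by (intro conjI allI ballI impI)
    (rule card_classes_eq_prod hyposylvester_class_packed ex1_inv_maximal; blast)+

end
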